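(* For all $u\in W^{1,\infty}(\Omega)$ there exists a unique $P_{\mathcal{D}}u\in X_{\mathcal{D}}$ satisfying $$\int_\Omega\Pi_{\mathcal{D}}P_{\mathcal{D}}u=\int_\Omega u$$ and $$\int_\Omega\frac{\nabla_{\mathcal{D}}P_{\mathcal{D}}u}{|\nabla_{\mathcal{D}}P_{\mathcal{D}}u|_\rho}\cdot\nabla_{\mathcal{D}}w=\int_\Omega\frac{\nabla u}{|\nabla u|_\rho}\cdot\nabla_{\mathcal{D}}w\qquad\text{for all }w\in X_{\mathcal{D}}.$$
   Context: $\Omega\subset\mathbb{R}^2$ is a bounded domain with Lipschitz boundary, $\rho>0$ is fixed, $|\cdot|_\rho:=\sqrt{\rho^2+|\cdot|^2}$. The triple $(X_{\mathcal{D}},\Pi_{\mathcal{D}},\nabla_{\mathcal{D}})$ is a gradient discretisation for homogeneous Neumann conditions: (i) $X_{\mathcal{D}}$ is a finite-dimensional real vector space; (ii) $\Pi_{\mathcal{D}}:X_{\mathcal{D}}\to L^\infty(\Omega)$ is linear; (iii) $\nabla_{\mathcal{D}}:X_{\mathcal{D}}\to L^\infty(\Omega)^2$ is linear and, for every $v\in X_{\mathcal{D}}$, $\nabla_{\mathcal{D}}v$ is piecewise polynomial of degree $N$ on a quasi-uniform mesh $\mathcal{T}$ of $\Omega$, meaning that there is $\sigma\in(0,1)$ with $\sigma h_\tau^2\le|\tau|_2$ (Lebesgue measure) and $\sigma h_{\mathcal{T}}\le h_\tau$ for each cell $\tau\in\mathcal{T}$, $h_\tau$ being the diameter of $\tau$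 and $h_{\mathcal{T}}=\max_\tau h_\tau$; (iv) there is $\bm{1}_{\mathcal{D}}\in X_{\mathcal{D}}$ with $\Pi_{\mathcal{D}}\bm{1}_{\mathcal{D}}=1$ and $\nabla_{\mathcal{D}}\bm{1}_{\mathcal{D}}=0$; (v) $\|v\|_{\mathcal{D}}:=|\int_\Omega\Pi_{\mathcal{D}}v|+\|\nabla_{\mathcal{D}}v\|_{L^1(\Omega)}$ is a norm on $X_{\mathcal{D}}$. *)

theory Defs
  imports "HOL-Analysis.Analysis"
begin

section \<open>Lipschitz domains in the plane\<close>

text \<open>Near each boundary point, in a suitable orthonormal coordinate system, the set is the
  strict epigraph of a Lipschitz function.\<close>

definition lipschitz_boundary :: "(real^2) set \<Rightarrow> bool" where
  "lipschitz_boundary \<Omega> \<longleftrightarrow>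
    (\<forall>x0\<in>frontier \<Omega>. \<exists>r>0. \<exists>Q :: real^2 \<Rightarrow> real^2. \<exists>\<gamma> :: real \<Rightarrow> real. \<exists>L.
       orthogonal_transformation Q \<and> L-lipschitz_on UNIV \<gamma> \<and>
       \<Omega> \<inter> ball x0 r = {x \<in> ball x0 r. \<gamma> (Q x $ 1) < Q x $ 2})"

definition bounded_lipschitz_domain :: "(real^2) set \<Rightarrow> bool" where
  "bounded_lipschitz_domain \<Omega> \<longleftrightarrow>
    open \<Omega> \<and> connected \<Omega> \<and> \<Omega> \<noteq> {} \<and> bounded \<Omega> \<and> lipschitz_boundary \<Omega>"


section \<open>Function spaces\<close>

text \<open>Elements of Lebesgue and Sobolev spaces are represented by functions on the whole plane, of
  which only the values on \<open>\<Omega>\<close> matter, and only up to null sets; equalities between elements are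
  therefore stated almost everywhere.\<close>

definition Linfty :: "(real^2) set \<Rightarrow> (real^2 \<Rightarrow> 'b::euclidean_space) set" where
  "Linfty \<Omega> = {f \<in> borel_measurable (lebesgue_on \<Omega>).
                 \<exists>C. AE x in lebesgue_on \<Omega>. norm (f x) \<le> C}"

definition partial_deriv :: "2 \<Rightarrow> (real^2 \<Rightarrow> real) \<Rightarrow> real^2 \<Rightarrow> real" where
  "partial_deriv i f x = frechet_derivative f (at x) (axis i 1)"

primrec C_k :: "nat \<Rightarrow> (real^2 \<Rightarrow> real) \<Rightarrow> bool" where
  "C_k 0 f \<longleftrightarrow> continuous_on UNIV f"
| "C_k (Suc k) f \<longleftrightarrow> f differentiable_on UNIV \<and> (\<forall>i. C_k k (partial_deriv i f))"

definition test_functions :: "(real^2) set \<Rightarrow> (real^2 \<Rightarrow> real) set" where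
  "test_functions \<Omega> =
    {\<phi>. (\<forall>k. C_k k \<phi>) \<and> compact (closure {x. \<phi> x \<noteq> 0}) \<and> closure {x. \<phi> x \<noteq> 0} \<subseteq> \<Omega>}"

definition is_bounded_weak_gradient ::
    "(real^2) set \<Rightarrow> (real^2 \<Rightarrow> real) \<Rightarrow> (real^2 \<Rightarrow> real^2) \<Rightarrow> bool" where
  "is_bounded_weak_gradient \<Omega> u g \<longleftrightarrow> g \<in> Linfty \<Omega> \<and>
    (\<forall>\<phi>\<in>test_functions \<Omega>. \<forall>i.
      (LINT x|lebesgue_on \<Omega>. u x * partial_deriv i \<phi> x) = - (LINT x|lebesgue_on \<Omega>. g x $ i * \<phi> x))"

definition W1_infty :: "(real^2) set \<Rightarrow> (real^2 \<Rightarrow> real) set" where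
  "W1_infty \<Omega> = {u \<in> Linfty \<Omega>. \<exists>g. is_bounded_weak_gradient \<Omega> u g}"


section \<open>Meshes and piecewise polynomials\<close>

text \<open>No shape of the cells (polygonal, convex, connected, ...) is prescribed.\<close>

definition is_mesh :: "(real^2) set \<Rightarrow> (real^2) set set \<Rightarrow> bool" where
  "is_mesh \<Omega> T \<longleftrightarrow> finite T \<and> (\<forall>\<tau>\<in>T. open \<tau> \<and> \<tau> \<noteq> {} \<and> \<tau> \<subseteq> \<Omega>) \<and> disjoint T \<and>
     negligible (\<Omega> - \<Union>T)"

definition mesh_size :: "(real^2) set set \<Rightarrow> real" where
  "mesh_size T = Max (diameter ` T)"

definition quasi_uniform_mesh :: "(real^2) set \<Rightarrow> (real^2) set set \<Rightarrow> bool" where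
  "quasi_uniform_mesh \<Omega> T \<longleftrightarrow> is_mesh \<Omega> T \<and>
    (\<exists>\<sigma>. 0 < \<sigma> \<and> \<sigma> < 1 \<and>
      (\<forall>\<tau>\<in>T. \<sigma> * (diameter \<tau>)\<^sup>2 \<le> measure lebesgue \<tau> \<and> \<sigma> * mesh_size T \<le> diameter \<tau>))"

text \<open>Vector fields whose two components are polynomials of total degree at most \<open>N\<close> on each
  cell.\<close>

definition piecewise_polynomial :: "nat \<Rightarrow> (real^2) set set \<Rightarrow> (real^2 \<Rightarrow> real^2) \<Rightarrow> bool" where
  "piecewise_polynomial N T f \<longleftrightarrow>
    (\<forall>\<tau>\<in>T. \<exists>c :: nat \<Rightarrow> nat \<Rightarrow> real^2. AE x in lebesgue_on \<tau>.
       f x = (\<Sum>i\<le>N. \<Sum>j\<le>N - i. ((x $ 1) ^ i * (x $ 2) ^ j) *\<^sub>R c i j))"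


section \<open>Gradient discretisations for homogeneous Neumann conditions\<close>

definition linear_into_Linfty ::
    "(real^2) set \<Rightarrow> ('x::real_vector \<Rightarrow> real^2 \<Rightarrow> 'b::euclidean_space) \<Rightarrow> bool" where
  "linear_into_Linfty \<Omega> F \<longleftrightarrow>
    (\<forall>v. F v \<in> Linfty \<Omega>) \<and>
    (\<forall>v w. AE x in lebesgue_on \<Omega>. F (v + w) x = F v x + F w x) \<and>
    (\<forall>a v. AE x in lebesgue_on \<Omega>. F (a *\<^sub>R v) x = a *\<^sub>R F v x)"

definition is_norm :: "('x::real_vector \<Rightarrow> real) \<Rightarrow> bool" where
  "is_norm p \<longleftrightarrow> (\<forall>v. 0 \<le> p v) \<and> (\<forall>v. p v = 0 \<longleftrightarrow> v = 0) \<and>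
    (\<forall>a v. p (a *\<^sub>R v) = \<bar>a\<bar> * p v) \<and> (\<forall>v w. p (v + w) \<le> p v + p w)"

definition GD_norm ::
    "(real^2) set \<Rightarrow> ('x \<Rightarrow> real^2 \<Rightarrow> real) \<Rightarrow> ('x \<Rightarrow> real^2 \<Rightarrow> real^2) \<Rightarrow> 'x \<Rightarrow> real" where
  "GD_norm \<Omega> PiD gradD v =
    \<bar>LINT x|lebesgue_on \<Omega>. PiD v x\<bar> + (LINT x|lebesgue_on \<Omega>. norm (gradD v x))"

text \<open>The space \<open>X\<^sub>D\<close> is the whole type \<open>'x\<close>.\<close>

locale gradient_discretisation =
  fixes \<Omega> :: "(real^2) set"
    and N :: nat
    and T :: "(real^2) set set"
    and PiD :: "'x::real_vector \<Rightarrow> real^2 \<Rightarrow> real"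
    and gradD :: "'x \<Rightarrow> real^2 \<Rightarrow> real^2"
  assumes finite_dimensional: "\<exists>B :: 'x set. finite B \<and> span B = UNIV"
    and linear_Pi: "linear_into_Linfty \<Omega> PiD"
    and linear_grad: "linear_into_Linfty \<Omega> gradD"
    and mesh: "quasi_uniform_mesh \<Omega> T"
    and polynomial_grad: "\<And>v. piecewise_polynomial N T (gradD v)"
    and unit: "\<exists>e. (AE x in lebesgue_on \<Omega>. PiD e x = 1) \<and> (AE x in lebesgue_on \<Omega>. gradD e x = 0)"
    and norm: "is_norm (GD_norm \<Omega> PiD gradD)"

definition rho_norm :: "real \<Rightarrow> real^2 \<Rightarrow> real" where
  "rho_norm \<rho> y = sqrt (\<rho>\<^sup>2 + (norm y)\<^sup>2)"

end

theory Submission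
  imports Defs
begin

text \<open>Put \<open>G = \<nabla>u / |\<nabla>u|\<^sub>\<rho>\<close>. Since \<open>\<nabla>u\<close> is bounded, \<open>|G| \<le> c\<close> almost everywhere for some \<open>c < 1\<close>, so
  \<open>J v = \<integral>(|\<nabla>\<^sub>D v|\<^sub>\<rho> - G \<bullet> \<nabla>\<^sub>D v) + |\<integral>\<Pi>\<^sub>D v - \<integral>u|\<close> is coercive and Lipschitz for the norm of the
  gradient discretisation, and attains its minimum on the finite-dimensional space \<open>X\<^sub>D\<close>. Adding a
  multiple of \<open>1\<^sub>D\<close> corrects the mean value of a minimiser without changing its gradient; the result
  minimises the integral part of \<open>J\<close> over all of \<open>X\<^sub>D\<close>, and its Euler-Lagrange equation is the required
  identity. Uniqueness follows from the strict monotonicity of \<open>y \<mapsto> y / |y|\<^sub>\<rho>\<close>, as equality of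
  gradients and mean values is equality in \<open>X\<^sub>D\<close>.\<close>

section \<open>Minimisation on a finite-dimensional normed space\<close>

lemma
  assumes "is_norm p"
  shows is_norm_nonneg: "0 \<le> p v"
    and is_norm_eq_0_iff: "p v = 0 \<longleftrightarrow> v = 0"
    and is_norm_scaleR: "p (a *\<^sub>R v) = \<bar>a\<bar> * p v"
    and is_norm_triangle: "p (v + w) \<le> p v + p w"
  using assms unfolding is_norm_def by blast+

lemma is_norm_minus_commute: "is_norm p \<Longrightarrow> p (v - w) = p (w - v)"
  using is_norm_scaleR[of p "-1" "w - v"] by simp

lemma is_norm_reverse_triangle: "is_norm p \<Longrightarrow> \<bar>p w - p v\<bar> \<le> p (w - v)"
  using is_norm_triangle[of p v "w - v"] is_norm_triangle[of p w "v - w"]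
    is_norm_minus_commute[of p v w] by simp

lemma is_norm_sum:
  assumes "is_norm p"
  shows "p (\<Sum>b\<in>B. c b *\<^sub>R b) \<le> (\<Sum>b\<in>B. \<bar>c b\<bar> * p b)"
proof (induction B rule: infinite_finite_induct)
  case (insert b B)
  then show ?case
    using is_norm_triangle[OF assms, of "c b *\<^sub>R b" "\<Sum>b\<in>B. c b *\<^sub>R b"]
    by (simp add: is_norm_scaleR[OF assms])
\<comment> \<open>For infinite or empty \<open>B\<close> both sums are 0 and the claim is
  \<open>p 0 \<le> 0\<close>.\<close>
qed (simp_all add: is_norm_eq_0_iff[OF assms, THEN iffD2])

text \<open>The vector space carries no topology, so continuity is expressed on coefficient
  functions with the product topology. A change of coefficients moves \<open>J\<close> by at most
  \<open>C\<close> times a sum of coordinate differences weighted by \<open>p b\<close>, and each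
  coordinate is continuous.\<close>

lemma continuous_on_linear_combination:
  fixes J :: "'x::real_vector \<Rightarrow> real" and B :: "'x set"
  assumes p: "is_norm p" and C: "0 \<le> C" and J: "\<And>v w. \<bar>J w - J v\<bar> \<le> C * p (w - v)"
  shows "continuous_on UNIV (\<lambda>c. J (\<Sum>b\<in>B. c b *\<^sub>R b))"
  unfolding continuous_on_def
proof safe
  fix c :: "'x \<Rightarrow> real"
  have coord: "((\<lambda>d. d b) \<longlongrightarrow> c b) (at c)" for b
    using continuous_on_product_coordinates[of b, where 'b=real]
    by (auto simp: continuous_on_def)
  have "((\<lambda>d. C * (\<Sum>b\<in>B. \<bar>d b - c b\<bar> * p b)) \<longlongrightarrow> C * (\<Sum>b\<in>B. \<bar>c b - c b\<bar> * p b)) (at c)"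
    by (intro tendsto_intros coord)
  then have lim: "((\<lambda>d. C * (\<Sum>b\<in>B. \<bar>d b - c b\<bar> * p b)) \<longlongrightarrow> 0) (at c)"
    by simp
  have "norm (J (\<Sum>b\<in>B. d b *\<^sub>R b) - J (\<Sum>b\<in>B. c b *\<^sub>R b))
      \<le> C * (\<Sum>b\<in>B. \<bar>d b - c b\<bar> * p b)" for d
  proof -
    have "\<bar>J (\<Sum>b\<in>B. d b *\<^sub>R b) - J (\<Sum>b\<in>B. c b *\<^sub>R b)\<bar>
        \<le> C * p (\<Sum>b\<in>B. (d b - c b) *\<^sub>R b)"
      using J[of "\<Sum>b\<in>B. d b *\<^sub>R b" "\<Sum>b\<in>B. c b *\<^sub>R b"]
      by (simp add: sum_subtractf scaleR_left_diff_distrib)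
    also have "\<dots> \<le> C * (\<Sum>b\<in>B. \<bar>d b - c b\<bar> * p b)"
      by (intro mult_left_mono is_norm_sum p C)
    finally show ?thesis by simp
  qed
  then have "\<forall>\<^sub>F d in at c. norm (J (\<Sum>b\<in>B. d b *\<^sub>R b) - J (\<Sum>b\<in>B. c b *\<^sub>R b))
      \<le> C * (\<Sum>b\<in>B. \<bar>d b - c b\<bar> * p b)"
    by (intro always_eventually allI)
  then have "((\<lambda>d. J (\<Sum>b\<in>B. d b *\<^sub>R b) - J (\<Sum>b\<in>B. c b *\<^sub>R b)) \<longlongrightarrow> 0) (at c)"
    using lim by (rule Lim_null_comparison)
  then show "((\<lambda>c. J (\<Sum>b\<in>B. c b *\<^sub>R b)) \<longlongrightarrow> J (\<Sum>b\<in>B. c b *\<^sub>R b)) (at c within UNIV)"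
    by (simp add: LIM_zero_iff)
qed

text \<open>Tychonoff's theorem: the box is a product of compact intervals. Coordinates outside
  \<open>B\<close> are pinned to 0, as a free real factor would destroy compactness.\<close>

lemma compact_coefficient_box:
  "compact {c :: 'x \<Rightarrow> real. \<forall>b. if b \<in> B then \<bar>c b\<bar> \<le> R else c b = 0}"
proof -
  let ?S = "\<lambda>b. if b \<in> B then {-R..R} else {0::real}"
  have "compactin (product_topology (\<lambda>i. euclidean) UNIV) (PiE UNIV ?S)"
    unfolding compactin_PiE by auto
  moreover have "PiE UNIV ?S = {c. \<forall>b. c b \<in> ?S b}"
    by (simp only: PiE_UNIV_domain Pi_def UNIV_I simp_thms)
  moreover have "\<dots> = {c. \<forall>b. if b \<in> B then \<bar>c b\<bar> \<le> R else c b = 0}"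
    by (rule Collect_cong, rule all_cong1) (auto simp: abs_le_iff)
  ultimately show ?thesis
    by (simp add: euclidean_product_topology)
qed

text \<open>One half of the equivalence of norms in finite dimension. The continuous function
  \<open>p\<close> attains its minimum on the compact unit sphere of the coefficient 1-norm;
  independence makes that minimum positive, and homogeneity extends the bound to all
  coefficients.\<close>

lemma linear_combination_norm_lower_bound:
  fixes B :: "'x::real_vector set"
  assumes p: "is_norm p" and B: "finite B" "independent B"
  shows "\<exists>m>0. \<forall>c. m * (\<Sum>b\<in>B. \<bar>c b\<bar>) \<le> p (\<Sum>b\<in>B. c b *\<^sub>R b)"
proof (cases "B = {}")
  case True
  \<comment> \<open>The sphere used below would be empty here, while the coefficient sum is 0, so
    any positive constant serves.\<close>
  then show ?thesis by (auto simp: is_norm_nonneg[OF p] intro: exI[of _ 1])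
next
  case False
  let ?box = "{c :: 'x \<Rightarrow> real. \<forall>b. if b \<in> B then \<bar>c b\<bar> \<le> 1 else c b = 0}"
  define S where "S = ?box \<inter> {c. (\<Sum>b\<in>B. \<bar>c b\<bar>) = 1}"
  obtain b0 where b0: "b0 \<in> B" using False by blast
  have "continuous_on UNIV (\<lambda>c. \<Sum>b\<in>B. \<bar>c b :: real\<bar>)"
    by (intro continuous_intros continuous_on_product_coordinates)
  then have "closed {c. (\<Sum>b\<in>B. \<bar>c b :: real\<bar>) = 1}"
    by (intro closed_Collect_eq) auto
  then have "compact S"
    unfolding S_def by (intro compact_Int_closed compact_coefficient_box)
  moreover have "S \<noteq> {}"
  proof -
    have "(\<lambda>b. if b = b0 then 1 else 0) \<in> S"
      using b0 B by (auto simp: S_def if_distrib[of abs] cong: if_cong)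
    then show ?thesis by blast
  qed
  moreover have "continuous_on S (\<lambda>c. p (\<Sum>b\<in>B. c b *\<^sub>R b))"
    by (intro continuous_on_subset[OF continuous_on_linear_combination[OF p, of 1]])
      (auto simp: is_norm_reverse_triangle[OF p])
  ultimately have "\<exists>c0\<in>S. \<forall>c\<in>S. p (\<Sum>b\<in>B. c0 b *\<^sub>R b) \<le> p (\<Sum>b\<in>B. c b *\<^sub>R b)"
    by (rule continuous_attains_inf)
  then obtain c0 where c0: "c0 \<in> S"
    and min: "\<And>c. c \<in> S \<Longrightarrow> p (\<Sum>b\<in>B. c0 b *\<^sub>R b) \<le> p (\<Sum>b\<in>B. c b *\<^sub>R b)"
    by meson
  define m where "m = p (\<Sum>b\<in>B. c0 b *\<^sub>R b)"
  have "m \<noteq> 0"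
  proof
    assume "m = 0"
    then have "(\<Sum>b\<in>B. c0 b *\<^sub>R b) = 0"
      by (simp add: m_def is_norm_eq_0_iff[OF p])
    then have "\<forall>b\<in>B. c0 b = 0"
      using B independentD by blast
    with c0 show False by (simp add: S_def)
  qed
  then have "0 < m"
    by (simp add: m_def is_norm_nonneg[OF p] order_less_le)
  moreover have "m * (\<Sum>b\<in>B. \<bar>c b\<bar>) \<le> p (\<Sum>b\<in>B. c b *\<^sub>R b)" for c
  proof (cases "(\<Sum>b\<in>B. \<bar>c b\<bar>) = 0")
    case True
    then show ?thesis by (simp add: is_norm_nonneg[OF p])
  next
    case False
    define s where "s = (\<Sum>b\<in>B. \<bar>c b\<bar>)"
    have s: "0 < s" using False by (simp add: s_def order_less_le sum_nonneg)
    \<comment> \<open>Normalisation onto the sphere; the values outside \<open>B\<close> are reset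
      to 0 because \<open>S\<close> demands it.\<close>
    let ?d = "\<lambda>b. if b \<in> B then c b / s else 0"
    have "\<bar>c b\<bar> \<le> s" if "b \<in> B" for b
      unfolding s_def using that B by (intro member_le_sum) auto
    moreover have "(\<Sum>b\<in>B. \<bar>?d b\<bar>) = 1"
    proof -
      have "(\<Sum>b\<in>B. \<bar>?d b\<bar>) = (\<Sum>b\<in>B. \<bar>c b\<bar> / s)"
        using s by (intro sum.cong) auto
      also have "\<dots> = 1" using s by (simp add: s_def flip: sum_divide_distrib)
      finally show ?thesis .
    qed
    ultimately have "?d \<in> S"
      using s by (auto simp: S_def)
    then have "m \<le> p (\<Sum>b\<in>B. ?d b *\<^sub>R b)"
      using min m_def by blast
    also have "(\<Sum>b\<in>B. ?d b *\<^sub>R b) = (1 / s) *\<^sub>R (\<Sum>b\<in>B. c b *\<^sub>R b)"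
      by (simp add: scaleR_sum_right)
    also have "p \<dots> = p (\<Sum>b\<in>B. c b *\<^sub>R b) / s"
      using s by (simp add: is_norm_scaleR[OF p])
    finally show ?thesis
      using s by (simp add: field_simps s_def)
  qed
  ultimately show ?thesis by blast
qed

text \<open>Outside a large enough coefficient box coercivity forces \<open>J\<close> above
  \<open>J 0\<close>, so the minimum over the compact box, which contains 0, is global.\<close>

proposition coercive_attains_min:
  fixes J :: "'x::real_vector \<Rightarrow> real"
  assumes fin: "\<exists>B :: 'x set. finite B \<and> span B = UNIV" and p: "is_norm p"
    and C: "0 \<le> C" and J: "\<And>v w. \<bar>J w - J v\<bar> \<le> C * p (w - v)"
    and a: "0 < a" and coercive: "\<And>v. a * p v - d \<le> J v"
  obtains v0 where "\<And>v. J v0 \<le> J v"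
proof -
  obtain A :: "'x set" where A: "finite A" "span A = UNIV" using fin by blast
  obtain B where B: "B \<subseteq> A" "independent B" "A \<subseteq> span B"
    by (rule maximal_independent_subset)
  have finB: "finite B" using B(1) A(1) by (rule finite_subset)
  have spanB: "span B = UNIV"
    using span_mono[OF B(3)] A(2) by (simp add: span_span top.extremum_unique)
  obtain m where m: "0 < m" "\<And>c. m * (\<Sum>b\<in>B. \<bar>c b\<bar>) \<le> p (\<Sum>b\<in>B. c b *\<^sub>R b)"
    using linear_combination_norm_lower_bound[OF p finB B(2)] by metis
  \<comment> \<open>Chosen so that \<open>a * m * R = \<bar>J 0 + d\<bar>\<close>: a single
    coefficient beyond \<open>R\<close> already gives \<open>J 0 \<le> J v\<close>. The absolute
    value keeps \<open>R\<close> nonnegative, so the box contains 0.\<close>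
  define R where "R = \<bar>J 0 + d\<bar> / (a * m)"
  define S :: "('x \<Rightarrow> real) set" where "S = {c. \<forall>b. if b \<in> B then \<bar>c b\<bar> \<le> R else c b = 0}"
  have zero: "(\<lambda>b. 0) \<in> S" using a m by (simp add: R_def S_def)
  have "continuous_on S (\<lambda>c. J (\<Sum>b\<in>B. c b *\<^sub>R b))"
    by (rule continuous_on_subset[OF continuous_on_linear_combination[OF p C J] subset_UNIV])
  moreover have "compact S" unfolding S_def by (rule compact_coefficient_box)
  ultimately have "\<exists>c0\<in>S. \<forall>c\<in>S. J (\<Sum>b\<in>B. c0 b *\<^sub>R b) \<le> J (\<Sum>b\<in>B. c b *\<^sub>R b)"
    using zero by (intro continuous_attains_inf) auto
  then obtain c0 where c0: "\<And>c. c \<in> S \<Longrightarrow> J (\<Sum>b\<in>B. c0 b *\<^sub>R b) \<le> J (\<Sum>b\<in>B. c b *\<^sub>R b)"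
    by meson
  have "J (\<Sum>b\<in>B. c0 b *\<^sub>R b) \<le> J v" for v
  proof -
    have "v \<in> range (\<lambda>c. \<Sum>b\<in>B. c b *\<^sub>R b)"
      using spanB span_finite[OF finB] by simp
    then obtain c where c: "v = (\<Sum>b\<in>B. c b *\<^sub>R b)" by (rule imageE)
    show ?thesis
    proof (cases "\<forall>b\<in>B. \<bar>c b\<bar> \<le> R")
      case True
      then have "J (\<Sum>b\<in>B. c0 b *\<^sub>R b) \<le> J (\<Sum>b\<in>B. (if b \<in> B then c b else 0) *\<^sub>R b)"
        by (intro c0) (auto simp: S_def)
      then show ?thesis by (simp add: c)
    next
      case False
      then obtain b where b: "b \<in> B" "R < \<bar>c b\<bar>" by force
      have "\<bar>c b\<bar> \<le> (\<Sum>b\<in>B. \<bar>c b\<bar>)"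
        using b finB by (intro member_le_sum) auto
      then have "a * (m * R) \<le> a * (m * (\<Sum>b\<in>B. \<bar>c b\<bar>))"
        using a m b by (intro mult_left_mono) auto
      also have "\<dots> \<le> a * p v"
        using a m by (simp add: c)
      finally have "J 0 + d \<le> a * p v"
        using a m by (simp add: R_def)
      then have "J 0 \<le> J v" using coercive[of v] by simp
      then show ?thesis using c0[OF zero] by simp
    qed
  qed
  then show ?thesis by (rule that)
qed


section \<open>The regularised norm\<close>

lemma rho_norm_pos: "0 < \<rho> \<Longrightarrow> 0 < rho_norm \<rho> y"
  by (simp add: rho_norm_def add_pos_nonneg)

lemma rho_norm_ge_rho: "\<rho> \<le> rho_norm \<rho> y"
  by (simp add: rho_norm_def real_le_rsqrt)

lemma rho_norm_ge_norm: "norm y \<le> rho_norm \<rho> y"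
  by (simp add: rho_norm_def real_le_rsqrt)

lemma rho_norm_square: "(rho_norm \<rho> y)\<^sup>2 = \<rho>\<^sup>2 + (norm y)\<^sup>2"
  by (simp add: rho_norm_def)

lemma continuous_on_rho_norm: "continuous_on UNIV (rho_norm \<rho>)"
  unfolding rho_norm_def[abs_def] by (intro continuous_intros)

lemma borel_measurable_rho_norm [measurable]: "rho_norm \<rho> \<in> borel_measurable borel"
  by (intro borel_measurable_continuous_onI continuous_on_rho_norm)

lemma norm_flux_le_1: "0 < \<rho> \<Longrightarrow> norm (y /\<^sub>R rho_norm \<rho> y) \<le> 1"
  using rho_norm_pos[of \<rho> y] rho_norm_ge_norm[of y \<rho>] by (simp add: field_simps)

text \<open>Monotonicity of \<open>s / sqrt (\<rho>\<^sup>2 + s\<^sup>2)\<close> in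
  \<open>s \<ge> 0\<close>. After cross-multiplying and squaring, the common term
  \<open>(norm y)\<^sup>2 * C\<^sup>2\<close> cancels. The bound lies strictly below 1, which is the
  source of coercivity.\<close>

lemma norm_flux_le:
  assumes "0 < \<rho>" "norm y \<le> C"
  shows "norm (y /\<^sub>R rho_norm \<rho> y) \<le> C / sqrt (\<rho>\<^sup>2 + C\<^sup>2)"
proof -
  have C: "0 \<le> C" using assms norm_ge_zero order_trans by blast
  have sq: "(norm y)\<^sup>2 \<le> C\<^sup>2" using assms by (intro power_mono) auto
  have "(norm y * sqrt (\<rho>\<^sup>2 + C\<^sup>2))\<^sup>2 \<le> (C * rho_norm \<rho> y)\<^sup>2"
    using mult_right_mono[OF sq, of "\<rho>\<^sup>2"]
    by (simp add: power_mult_distrib rho_norm_square algebra_simps)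
  then have "norm y * sqrt (\<rho>\<^sup>2 + C\<^sup>2) \<le> C * rho_norm \<rho> y"
    using C rho_norm_pos[OF assms(1), of y] by (auto intro: power2_le_imp_le)
  moreover have "0 < sqrt (\<rho>\<^sup>2 + C\<^sup>2)" using assms by (simp add: add_pos_nonneg)
  ultimately show ?thesis
    using rho_norm_pos[OF assms(1), of y] by (simp add: field_simps)
qed

text \<open>Strict Cauchy-Schwarz for the vectors \<open>(\<rho>, y)\<close> and
  \<open>(\<rho>, z)\<close>, which are parallel only if equal. The difference of the two squares is
  \<open>\<rho>\<^sup>2 * (norm (y - z))\<^sup>2\<close> plus the Cauchy-Schwarz defect of
  \<open>y\<close> and \<open>z\<close>.\<close>

lemma rho_norm_mult_gt:
  assumes "0 < \<rho>" "y \<noteq> z"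
  shows "\<rho>\<^sup>2 + y \<bullet> z < rho_norm \<rho> y * rho_norm \<rho> z"
proof (rule power2_less_imp_less)
  have "0 < \<rho>\<^sup>2 * (norm (y - z))\<^sup>2" using assms by simp
  moreover have "(y \<bullet> z)\<^sup>2 \<le> (norm y)\<^sup>2 * (norm z)\<^sup>2"
    by (metis Cauchy_Schwarz_ineq power2_norm_eq_inner)
  moreover have "(norm (y - z))\<^sup>2 = (norm y)\<^sup>2 + (norm z)\<^sup>2 - 2 * (y \<bullet> z)"
    by (simp add: power2_norm_eq_inner algebra_simps inner_commute)
  ultimately show "(\<rho>\<^sup>2 + y \<bullet> z)\<^sup>2 < (rho_norm \<rho> y * rho_norm \<rho> z)\<^sup>2"
    by (simp add: power_mult_distrib rho_norm_square) (simp add: power2_sum algebra_simps)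
qed (use rho_norm_pos[OF assms(1)] in \<open>simp add: less_imp_le\<close>)

text \<open>The flux \<open>y /\<^sub>R rho_norm \<rho> y\<close> is the gradient of
  \<open>rho_norm \<rho>\<close> at \<open>y\<close>, so this is the strict tangent-plane
  inequality; multiplied by \<open>rho_norm \<rho> y\<close> it becomes
  \<open>rho_norm_mult_gt\<close>.\<close>

lemma rho_norm_strictly_convex:
  assumes "0 < \<rho>" "y \<noteq> z"
  shows "rho_norm \<rho> y + (y /\<^sub>R rho_norm \<rho> y) \<bullet> (z - y) < rho_norm \<rho> z"
proof -
  have "(rho_norm \<rho> y)\<^sup>2 + y \<bullet> (z - y) < rho_norm \<rho> y * rho_norm \<rho> z"
    using rho_norm_mult_gt[OF assms]
    by (simp add: rho_norm_square power2_norm_eq_inner inner_diff_right)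
  then show ?thesis
    using rho_norm_pos[OF assms(1), of y] by (simp add: field_simps power2_eq_square)
qed

lemma rho_norm_convex:
  assumes "0 < \<rho>"
  shows "rho_norm \<rho> y + (y /\<^sub>R rho_norm \<rho> y) \<bullet> (z - y) \<le> rho_norm \<rho> z"
  using rho_norm_strictly_convex[OF assms, of y z] by (cases "y = z") auto

text \<open>Sum of the strict tangent-plane inequalities at \<open>y\<close> and at
  \<open>z\<close>.\<close>

lemma flux_strictly_monotone:
  assumes "0 < \<rho>" "y \<noteq> z"
  shows "0 < (y /\<^sub>R rho_norm \<rho> y - z /\<^sub>R rho_norm \<rho> z) \<bullet> (y - z)"
  using rho_norm_strictly_convex[OF assms] rho_norm_strictly_convex[OF assms(1), of z y] assms(2)
  by (simp add: inner_diff_left inner_diff_right)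

lemma flux_monotone:
  assumes "0 < \<rho>"
  shows "0 \<le> (y /\<^sub>R rho_norm \<rho> y - z /\<^sub>R rho_norm \<rho> z) \<bullet> (y - z)"
  using flux_strictly_monotone[OF assms, of y z] by (cases "y = z") auto

lemma rho_norm_lipschitz:
  assumes "0 < \<rho>"
  shows "\<bar>rho_norm \<rho> z - rho_norm \<rho> y\<bar> \<le> norm (z - y)"
proof -
  have "rho_norm \<rho> z - rho_norm \<rho> y \<le> norm (z - y)" for y z
  proof -
    have "rho_norm \<rho> z - rho_norm \<rho> y \<le> (z /\<^sub>R rho_norm \<rho> z) \<bullet> (z - y)"
      using rho_norm_convex[OF assms, of z y] by (simp add: inner_diff_right)
    also have "\<dots> \<le> norm (z /\<^sub>R rho_norm \<rho> z) * norm (z - y)"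
      by (rule norm_cauchy_schwarz)
    also have "\<dots> \<le> 1 * norm (z - y)"
      using norm_flux_le_1[OF assms, of z] by (intro mult_right_mono) auto
    finally show ?thesis by simp
  qed
  from this[of y z] this[of z y] show ?thesis
    by (simp add: abs_le_iff norm_minus_commute)
qed

text \<open>Concavity of the square root, \<open>sqrt (s\<^sup>2 + d) \<le> s + d / (2 * s)\<close>; this one-sided quadratic
  bound replaces differentiation under the integral sign.\<close>

lemma rho_norm_add_le:
  assumes "0 < \<rho>"
  shows "rho_norm \<rho> (y + h) \<le> rho_norm \<rho> y + (y /\<^sub>R rho_norm \<rho> y) \<bullet> h + (norm h)\<^sup>2 / (2 * \<rho>)"
proof -
  define s where "s = rho_norm \<rho> y"
  define t where "t = rho_norm \<rho> (y + h)"
  have s: "0 < s" using rho_norm_pos[OF assms] by (simp add: s_def)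
  have "t\<^sup>2 = s\<^sup>2 + 2 * (y \<bullet> h) + (norm h)\<^sup>2"
    by (simp add: s_def t_def rho_norm_square power2_norm_eq_inner algebra_simps inner_commute)
  moreover have "0 \<le> (t - s)\<^sup>2" by simp
  ultimately have "2 * s * t \<le> 2 * s\<^sup>2 + 2 * (y \<bullet> h) + (norm h)\<^sup>2"
    by (simp add: power2_diff algebra_simps)
  then have "2 * s * t / (2 * s) \<le> (2 * s\<^sup>2 + 2 * (y \<bullet> h) + (norm h)\<^sup>2) / (2 * s)"
    using s by (intro divide_right_mono) auto
  then have "t \<le> s + (y /\<^sub>R s) \<bullet> h + (norm h)\<^sup>2 / (2 * s)"
    using s by (simp add: add_divide_distrib power2_eq_square inverse_eq_divide)
  \<comment> \<open>Using \<open>\<rho> \<le> s\<close> makes the coefficient of the quadratic error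
    independent of \<open>y\<close>.\<close>
  moreover have "(norm h)\<^sup>2 / (2 * s) \<le> (norm h)\<^sup>2 / (2 * \<rho>)"
    using assms rho_norm_ge_rho[of \<rho> y] by (intro divide_left_mono) (auto simp: s_def)
  ultimately show ?thesis by (simp add: s_def t_def)
qed


section \<open>Integrals of bounded functions\<close>

lemma Linfty_measurable: "f \<in> Linfty \<Omega> \<Longrightarrow> f \<in> borel_measurable (lebesgue_on \<Omega>)"
  by (simp add: Linfty_def)

lemma Linfty_integrable:
  assumes "\<Omega> \<in> lmeasurable" "f \<in> Linfty \<Omega>"
  shows "integrable (lebesgue_on \<Omega>) f"
proof -
  interpret finite_measure "lebesgue_on \<Omega>"
    by (rule finite_measure_lebesgue_on[OF assms(1)])
  show ?thesis
    using assms(2) integrable_const_bound by (auto simp: Linfty_def)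
qed

lemma LinftyI:
  "f \<in> borel_measurable (lebesgue_on \<Omega>) \<Longrightarrow> AE x in lebesgue_on \<Omega>. norm (f x) \<le> C \<Longrightarrow> f \<in> Linfty \<Omega>"
  by (auto simp: Linfty_def)

lemma Linfty_norm: "f \<in> Linfty \<Omega> \<Longrightarrow> (\<lambda>x. norm (f x)) \<in> Linfty \<Omega>"
  by (auto simp: Linfty_def)

lemma Linfty_inner:
  assumes "f \<in> Linfty \<Omega>" "g \<in> Linfty \<Omega>"
  shows "(\<lambda>x. f x \<bullet> g x) \<in> Linfty \<Omega>"
proof -
  obtain C D where "AE x in lebesgue_on \<Omega>. norm (f x) \<le> C" "AE x in lebesgue_on \<Omega>. norm (g x) \<le> D"
    using assms by (auto simp: Linfty_def)
  then have "AE x in lebesgue_on \<Omega>. norm (f x \<bullet> g x) \<le> C * D"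
  proof eventually_elim
    case (elim x)
    then have "norm (f x) * norm (g x) \<le> C * D"
      by (intro mult_mono) (auto intro: order_trans[OF norm_ge_zero])
    then show ?case using Cauchy_Schwarz_ineq2[of "f x" "g x"] by simp
  qed
  then show ?thesis
    using assms by (intro LinftyI borel_measurable_inner) (auto simp: Linfty_measurable)
qed

lemma Linfty_flux:
  assumes "0 < \<rho>" "f \<in> Linfty \<Omega>"
  shows "(\<lambda>x. f x /\<^sub>R rho_norm \<rho> (f x)) \<in> Linfty \<Omega>"
proof -
  have [measurable]: "f \<in> borel_measurable (lebesgue_on \<Omega>)" using assms Linfty_measurable by blast
  show ?thesis
    by (rule LinftyI[where C = 1]) (measurable, simp only: norm_flux_le_1[OF assms(1)] AE_I2)
qed

lemma Linfty_rho_norm: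
  assumes "0 < \<rho>" "f \<in> Linfty \<Omega>"
  shows "(\<lambda>x. rho_norm \<rho> (f x)) \<in> Linfty \<Omega>"
proof -
  have [measurable]: "f \<in> borel_measurable (lebesgue_on \<Omega>)" using assms Linfty_measurable by blast
  obtain C where "AE x in lebesgue_on \<Omega>. norm (f x) \<le> C"
    using assms by (auto simp: Linfty_def)
  then have "AE x in lebesgue_on \<Omega>. norm (rho_norm \<rho> (f x)) \<le> \<bar>rho_norm \<rho> 0\<bar> + C"
  proof eventually_elim
    case (elim x)
    then show ?case using rho_norm_lipschitz[OF assms(1), of "f x" 0] by simp
  qed
  then show ?thesis by (rule LinftyI[rotated]) measurable
qed

section \<open>Linearity modulo null sets\<close>

lemma linear_into_Linfty_diff:
  assumes "linear_into_Linfty \<Omega> F"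
  shows "AE x in lebesgue_on \<Omega>. F (v - w) x = F v x - F w x"
proof -
  have "AE x in lebesgue_on \<Omega>. F (v + (-1) *\<^sub>R w) x = F v x + F ((-1) *\<^sub>R w) x"
    "AE x in lebesgue_on \<Omega>. F ((-1) *\<^sub>R w) x = (-1) *\<^sub>R F w x"
    using assms unfolding linear_into_Linfty_def by blast+
  then show ?thesis by eventually_elim simp
qed

lemma linear_into_Linfty_add_scaleR:
  assumes "linear_into_Linfty \<Omega> F"
  shows "AE x in lebesgue_on \<Omega>. F (v + t *\<^sub>R w) x = F v x + t *\<^sub>R F w x"
proof -
  have "AE x in lebesgue_on \<Omega>. F (v + t *\<^sub>R w) x = F v x + F (t *\<^sub>R w) x"
    "AE x in lebesgue_on \<Omega>. F (t *\<^sub>R w) x = t *\<^sub>R F w x"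
    using assms unfolding linear_into_Linfty_def by blast+
  then show ?thesis by eventually_elim simp
qed

lemma linear_into_Linfty_integral_add_scaleR:
  assumes "linear_into_Linfty \<Omega> F" "\<Omega> \<in> lmeasurable"
  shows "(LINT x|lebesgue_on \<Omega>. F (v + t *\<^sub>R w) x)
    = (LINT x|lebesgue_on \<Omega>. F v x) + t *\<^sub>R (LINT x|lebesgue_on \<Omega>. F w x)"
proof -
  have F: "F v \<in> Linfty \<Omega>" for v using assms(1) by (simp add: linear_into_Linfty_def)
  note int = Linfty_integrable[OF assms(2) F]
  have "(LINT x|lebesgue_on \<Omega>. F (v + t *\<^sub>R w) x) = (LINT x|lebesgue_on \<Omega>. F v x + t *\<^sub>R F w x)"
    using int by (intro integral_cong_AE linear_into_Linfty_add_scaleR[OF assms(1)]) auto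
  then show ?thesis using int by simp
qed


section \<open>The energy functional\<close>

text \<open>Convex functional of the gradient field whose Euler-Lagrange equation equates the flux
  of \<open>f\<close> with \<open>G\<close> when tested against discrete gradients.\<close>

definition energy ::
    "(real^2) set \<Rightarrow> real \<Rightarrow> (real^2 \<Rightarrow> real^2) \<Rightarrow> (real^2 \<Rightarrow> real^2) \<Rightarrow> real" where
  "energy \<Omega> \<rho> G f = (LINT x|lebesgue_on \<Omega>. rho_norm \<rho> (f x) - G x \<bullet> f x)"

context
  fixes \<Omega> :: "(real^2) set" and \<rho> :: real and G :: "real^2 \<Rightarrow> real^2"
  assumes lmeas: "\<Omega> \<in> lmeasurable" and rho: "0 < \<rho>" and G: "G \<in> Linfty \<Omega>"
begin

lemma energy_integrable: "f \<in> Linfty \<Omega> \<Longrightarrow> integrable (lebesgue_on \<Omega>) (\<lambda>x. rho_norm \<rho> (f x) - G x \<bullet> f x)"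
  by (intro Bochner_Integration.integrable_diff Linfty_integrable[OF lmeas] Linfty_rho_norm
      Linfty_inner rho G)

lemma energy_cong:
  assumes "f \<in> Linfty \<Omega>" "g \<in> Linfty \<Omega>" "AE x in lebesgue_on \<Omega>. f x = g x"
  shows "energy \<Omega> \<rho> G f = energy \<Omega> \<rho> G g"
  unfolding energy_def using energy_integrable[OF assms(1)] energy_integrable[OF assms(2)] assms(3)
  by (intro integral_cong_AE) auto

text \<open>The constant 2 adds the Lipschitz constant 1 of \<open>rho_norm \<rho>\<close> to the
  bound 1 on \<open>G\<close>. The increment is a separate function \<open>h\<close> because the
  discrete gradient of a difference is the difference of gradients only almost everywhere.\<close>

lemma energy_lipschitz:
  assumes G1: "AE x in lebesgue_on \<Omega>. norm (G x) \<le> 1"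
    and f: "f \<in> Linfty \<Omega>" and g: "g \<in> Linfty \<Omega>" and h: "h \<in> Linfty \<Omega>"
    and eq: "AE x in lebesgue_on \<Omega>. h x = g x - f x"
  shows "\<bar>energy \<Omega> \<rho> G g - energy \<Omega> \<rho> G f\<bar> \<le> 2 * (LINT x|lebesgue_on \<Omega>. norm (h x))"
proof -
  let ?e = "\<lambda>f x. rho_norm \<rho> (f x) - G x \<bullet> f x"
  note int = energy_integrable[OF f] energy_integrable[OF g] Linfty_integrable[OF lmeas Linfty_norm[OF h]]
  have "\<bar>LINT x|lebesgue_on \<Omega>. ?e g x - ?e f x\<bar> \<le> (LINT x|lebesgue_on \<Omega>. \<bar>?e g x - ?e f x\<bar>)"
    by (rule integral_abs_bound)
  also have "\<dots> \<le> (LINT x|lebesgue_on \<Omega>. 2 * norm (h x))"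
  proof (rule integral_mono_AE)
    show "AE x in lebesgue_on \<Omega>. \<bar>?e g x - ?e f x\<bar> \<le> 2 * norm (h x)"
      using G1 eq
    proof eventually_elim
      case (elim x)
      have "\<bar>G x \<bullet> (g x - f x)\<bar> \<le> norm (G x) * norm (g x - f x)"
        by (rule Cauchy_Schwarz_ineq2)
      also have "\<dots> \<le> 1 * norm (g x - f x)"
        using elim by (intro mult_right_mono) auto
      finally show ?case
        using rho_norm_lipschitz[OF rho, of "g x" "f x"] elim by (simp add: inner_diff_right)
    qed
  qed (use int in auto)
  finally show ?thesis using int by (simp add: energy_def)
qed

text \<open>Pointwise, \<open>rho_norm\<close> dominates the norm and the linear term takes away at
  most \<open>c\<close> times the norm.\<close>

lemma energy_coercive:
  assumes Gc: "AE x in lebesgue_on \<Omega>. norm (G x) \<le> c" and f: "f \<in> Linfty \<Omega>"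
  shows "(1 - c) * (LINT x|lebesgue_on \<Omega>. norm (f x)) \<le> energy \<Omega> \<rho> G f"
proof -
  note int = energy_integrable[OF f] Linfty_integrable[OF lmeas Linfty_norm[OF f]]
  have "(LINT x|lebesgue_on \<Omega>. (1 - c) * norm (f x)) \<le> energy \<Omega> \<rho> G f"
    unfolding energy_def
  proof (rule integral_mono_AE)
    show "AE x in lebesgue_on \<Omega>. (1 - c) * norm (f x) \<le> rho_norm \<rho> (f x) - G x \<bullet> f x"
      using Gc
    proof eventually_elim
      case (elim x)
      have "G x \<bullet> f x \<le> norm (G x) * norm (f x)" by (rule norm_cauchy_schwarz)
      also have "\<dots> \<le> c * norm (f x)" using elim by (intro mult_right_mono) auto
      finally show ?case using rho_norm_ge_norm[of "f x" \<rho>] by (simp add: algebra_simps)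
    qed
  qed (use int in auto)
  then show ?thesis using int by simp
qed

text \<open>Integrated form of \<open>rho_norm_add_le\<close>: the coefficient of \<open>t\<close>
  is the first variation of the energy at \<open>f\<close> in the direction
  \<open>g\<close>.\<close>

lemma energy_add_le:
  assumes f: "f \<in> Linfty \<Omega>" and g: "g \<in> Linfty \<Omega>" and h: "h \<in> Linfty \<Omega>"
    and eq: "AE x in lebesgue_on \<Omega>. h x = f x + t *\<^sub>R g x"
  shows "energy \<Omega> \<rho> G h \<le> energy \<Omega> \<rho> G f
    + t * ((LINT x|lebesgue_on \<Omega>. (f x /\<^sub>R rho_norm \<rho> (f x)) \<bullet> g x) - (LINT x|lebesgue_on \<Omega>. G x \<bullet> g x))
    + t\<^sup>2 * (LINT x|lebesgue_on \<Omega>. g x \<bullet> g x) / (2 * \<rho>)"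
proof -
  let ?r = "\<lambda>x. (rho_norm \<rho> (f x) - G x \<bullet> f x)
    + t * ((f x /\<^sub>R rho_norm \<rho> (f x)) \<bullet> g x - G x \<bullet> g x) + t\<^sup>2 * (g x \<bullet> g x) / (2 * \<rho>)"
  note int = energy_integrable[OF f] energy_integrable[OF h]
    Linfty_integrable[OF lmeas Linfty_inner[OF Linfty_flux[OF rho f] g]]
    Linfty_integrable[OF lmeas Linfty_inner[OF G g]] Linfty_integrable[OF lmeas Linfty_inner[OF g g]]
  have "energy \<Omega> \<rho> G h \<le> (LINT x|lebesgue_on \<Omega>. ?r x)"
    unfolding energy_def
  proof (rule integral_mono_AE)
    show "AE x in lebesgue_on \<Omega>. rho_norm \<rho> (h x) - G x \<bullet> h x \<le> ?r x"
      using eq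
    proof eventually_elim
      case (elim x)
      show ?case
        using rho_norm_add_le[OF rho, of "f x" "t *\<^sub>R g x"] elim
        by (simp add: algebra_simps power_mult_distrib power2_norm_eq_inner)
    qed
    show "integrable (lebesgue_on \<Omega>) ?r"
      by (intro Bochner_Integration.integrable_add Bochner_Integration.integrable_diff
          integrable_mult_right integrable_divide int)
  qed (rule int)
  also have "\<dots> = energy \<Omega> \<rho> G f
    + t * ((LINT x|lebesgue_on \<Omega>. (f x /\<^sub>R rho_norm \<rho> (f x)) \<bullet> g x) - (LINT x|lebesgue_on \<Omega>. G x \<bullet> g x))
    + t\<^sup>2 * (LINT x|lebesgue_on \<Omega>. g x \<bullet> g x) / (2 * \<rho>)"
    unfolding energy_def using int
    by (simp del: inner_scaleR_left)
  finally show ?thesis .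
qed

end

lemma linear_lower_bound_imp_zero:
  fixes D K :: real
  assumes "\<And>t. 0 \<le> t * D + t\<^sup>2 * K"
  shows "D = 0"
proof (rule ccontr)
  assume "D \<noteq> 0"
  \<comment> \<open>At \<open>t = - s * D\<close> the linear term is \<open>- s * D\<^sup>2\<close>,
    and \<open>s * \<bar>K\<bar> < 1\<close> keeps the quadratic term from compensating it.\<close>
  define s where "s = 1 / (\<bar>K\<bar> + 1)"
  have s: "0 < s" "s * \<bar>K\<bar> < 1" by (simp_all add: s_def)
  have "0 \<le> (- s * D) * D + (- s * D)\<^sup>2 * K" by (rule assms)
  also have "\<dots> = (s * D\<^sup>2) * (s * K - 1)" by (simp add: power2_eq_square algebra_simps)
  finally have "0 \<le> s * K - 1"
    using s \<open>D \<noteq> 0\<close> by (subst (asm) zero_le_mult_iff) (auto simp: mult_le_0_iff)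
  moreover have "s * K \<le> s * \<bar>K\<bar>" using s by (intro mult_left_mono) auto
  ultimately show False using s by simp
qed


section \<open>Minimisers and solutions\<close>

context gradient_discretisation
begin

lemma gradD_Linfty: "gradD v \<in> Linfty \<Omega>"
  using linear_grad by (simp add: linear_into_Linfty_def)

lemma mean_add_scaleR:
  assumes "\<Omega> \<in> lmeasurable"
  shows "(LINT x|lebesgue_on \<Omega>. PiD (v + t *\<^sub>R w) x)
    = (LINT x|lebesgue_on \<Omega>. PiD v x) + t * (LINT x|lebesgue_on \<Omega>. PiD w x)"
  using linear_into_Linfty_integral_add_scaleR[OF linear_Pi assms, of v t w] by simp

lemma mean_diff:
  assumes "\<Omega> \<in> lmeasurable"
  shows "(LINT x|lebesgue_on \<Omega>. PiD (v - w) x)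
    = (LINT x|lebesgue_on \<Omega>. PiD v x) - (LINT x|lebesgue_on \<Omega>. PiD w x)"
  using mean_add_scaleR[OF assms, of v "-1" w] by simp

lemma minimiser_exists:
  assumes lmeas: "\<Omega> \<in> lmeasurable" and area: "measure lebesgue \<Omega> \<noteq> 0" and rho: "0 < \<rho>"
    and G: "G \<in> Linfty \<Omega>" and Gc: "AE x in lebesgue_on \<Omega>. norm (G x) \<le> c" and "c < 1"
  shows "\<exists>q. (LINT x|lebesgue_on \<Omega>. PiD q x) = m \<and>
    (\<forall>v. energy \<Omega> \<rho> G (gradD q) \<le> energy \<Omega> \<rho> G (gradD v))"
proof -
  let ?M = "lebesgue_on \<Omega>"
  let ?p = "GD_norm \<Omega> PiD gradD"
  let ?mean = "\<lambda>v. LINT x|?M. PiD v x"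
  let ?E = "\<lambda>v. energy \<Omega> \<rho> G (gradD v)"
  have G1: "AE x in ?M. norm (G x) \<le> 1"
    using Gc by (rule eventually_mono) (use \<open>c < 1\<close> in simp)
  \<comment> \<open>The energy does not see the direction of the unit element, whose gradient
    vanishes; the penalty on the mean restores coercivity there.\<close>
  define J where "J = (\<lambda>v. ?E v + \<bar>?mean v - m\<bar>)"
  have J_lipschitz: "\<bar>J w - J v\<bar> \<le> 2 * ?p (w - v)" for v w
  proof -
    have "\<bar>(a + \<bar>x - m\<bar>) - (b + \<bar>y - m\<bar>)\<bar> \<le> \<bar>a - b\<bar> + \<bar>x - y\<bar>" for a b x y m :: real
      by arith
    then have "\<bar>J w - J v\<bar> \<le> \<bar>?E w - ?E v\<bar> + \<bar>?mean w - ?mean v\<bar>"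
      unfolding J_def .
    also have "\<bar>?E w - ?E v\<bar> \<le> 2 * (LINT x|?M. norm (gradD (w - v) x))"
      by (rule energy_lipschitz[OF lmeas rho G G1 gradD_Linfty gradD_Linfty gradD_Linfty
            linear_into_Linfty_diff[OF linear_grad]])
    also have "\<bar>?mean w - ?mean v\<bar> \<le> 2 * \<bar>?mean (w - v)\<bar>"
      by (simp add: mean_diff[OF lmeas])
    finally show ?thesis by (simp add: GD_norm_def)
  qed
  \<comment> \<open>The gradient part has weight \<open>1 - c\<close> and the mean part weight 1;
    replacing the mean's distance to \<open>m\<close> by its absolute value costs
    \<open>\<bar>m\<bar>\<close>.\<close>
  have J_coercive: "min 1 (1 - c) * ?p v - \<bar>m\<bar> \<le> J v" for v
  proof -
    have "0 \<le> (LINT x|?M. norm (gradD v x))" by (rule integral_nonneg_AE) simp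
    then have "min 1 (1 - c) * (LINT x|?M. norm (gradD v x))
        \<le> (1 - c) * (LINT x|?M. norm (gradD v x))"
      by (intro mult_right_mono) auto
    moreover have "min 1 (1 - c) * \<bar>?mean v\<bar> \<le> 1 * \<bar>?mean v\<bar>"
      by (intro mult_right_mono) auto
    ultimately show ?thesis
      using energy_coercive[OF lmeas rho G Gc gradD_Linfty, of v]
      by (simp add: J_def GD_norm_def distrib_left)
  qed
  have "0 < min 1 (1 - c)" using \<open>c < 1\<close> by simp
  then obtain v0 where v0: "\<And>v. J v0 \<le> J v"
    using coercive_attains_min[OF finite_dimensional norm _ J_lipschitz _ J_coercive] by auto

  obtain e where e: "AE x in ?M. PiD e x = 1" "AE x in ?M. gradD e x = 0"
    using unit by auto
  have "?mean e = (LINT x|?M. 1)"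
    using e(1) linear_Pi by (intro integral_cong_AE) (auto simp: linear_into_Linfty_def Linfty_def)
  also have "\<dots> = measure lebesgue \<Omega>"
    using lmeas by (simp add: measure_restrict_space)
  finally have mean_e: "?mean e = measure lebesgue \<Omega>" .
  \<comment> \<open>The unit element has mean integral \<open>measure lebesgue \<Omega>\<close>, so
    this multiple of it brings the integral to exactly \<open>m\<close>.\<close>
  define shift where "shift = (\<lambda>v. v + ((m - ?mean v) / measure lebesgue \<Omega>) *\<^sub>R e)"
  have mean_shift: "?mean (shift v) = m" for v
    using area by (simp add: shift_def mean_add_scaleR[OF lmeas] mean_e)
  have grad_shift: "AE x in ?M. gradD (shift v) x = gradD v x" for v
    unfolding shift_def
    using linear_into_Linfty_add_scaleR[OF linear_grad, of v _ e] e(2) by eventually_elim simp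
  have E_shift: "?E (shift v) = ?E v" for v
    by (rule energy_cong[OF lmeas rho G gradD_Linfty gradD_Linfty grad_shift])
  \<comment> \<open>The chain is
    \<open>?E (shift v0) = ?E v0 \<le> J v0 \<le> J (shift v) = ?E v\<close>, the last penalty being
    0.\<close>
  have "?E (shift v0) \<le> ?E v" for v
    using v0[of "shift v"] by (simp add: J_def mean_shift E_shift)
  then show ?thesis using mean_shift by auto
qed

text \<open>Along \<open>q + t *\<^sub>R w\<close> minimality and \<open>energy_add_le\<close> bound
  a quadratic in \<open>t\<close> without constant term below by 0 for both signs of
  \<open>t\<close>, so its slope vanishes.\<close>

lemma euler_lagrange:
  assumes lmeas: "\<Omega> \<in> lmeasurable" and rho: "0 < \<rho>" and G: "G \<in> Linfty \<Omega>"
    and min: "\<And>v. energy \<Omega> \<rho> G (gradD q) \<le> energy \<Omega> \<rho> G (gradD v)"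
  shows "(LINT x|lebesgue_on \<Omega>. (gradD q x /\<^sub>R rho_norm \<rho> (gradD q x)) \<bullet> gradD w x)
    = (LINT x|lebesgue_on \<Omega>. G x \<bullet> gradD w x)" (is "?l = ?r")
proof -
  have "0 \<le> t * (?l - ?r) + t\<^sup>2 * ((LINT x|lebesgue_on \<Omega>. gradD w x \<bullet> gradD w x) / (2 * \<rho>))" for t
    using min[of "q + t *\<^sub>R w"]
      energy_add_le[OF lmeas rho G gradD_Linfty gradD_Linfty gradD_Linfty
        linear_into_Linfty_add_scaleR[OF linear_grad], of q t w]
    by simp
  then have "?l - ?r = 0" by (rule linear_lower_bound_imp_zero)
  then show ?thesis by simp
qed

text \<open>Testing with \<open>r - q\<close> gives a nonnegative integrand of integral 0. It
  vanishes almost everywhere, strict monotonicity identifies the gradients, and equal means make the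
  norm of \<open>r - q\<close> zero.\<close>

lemma flux_solution_unique:
  assumes lmeas: "\<Omega> \<in> lmeasurable" and rho: "0 < \<rho>"
    and mean: "(LINT x|lebesgue_on \<Omega>. PiD r x) = (LINT x|lebesgue_on \<Omega>. PiD q x)"
    and flux: "\<And>w. (LINT x|lebesgue_on \<Omega>. (gradD r x /\<^sub>R rho_norm \<rho> (gradD r x)) \<bullet> gradD w x)
      = (LINT x|lebesgue_on \<Omega>. (gradD q x /\<^sub>R rho_norm \<rho> (gradD q x)) \<bullet> gradD w x)"
  shows "r = q"
proof -
  let ?M = "lebesgue_on \<Omega>"
  let ?F = "\<lambda>v x. gradD v x /\<^sub>R rho_norm \<rho> (gradD v x)"
  let ?d = "\<lambda>x. ?F r x \<bullet> gradD (r - q) x - ?F q x \<bullet> gradD (r - q) x"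
  have int: "integrable ?M (\<lambda>x. ?F v x \<bullet> gradD w x)" for v w
    by (rule Linfty_integrable[OF lmeas Linfty_inner[OF Linfty_flux[OF rho gradD_Linfty] gradD_Linfty]])
  have diff: "AE x in ?M. gradD (r - q) x = gradD r x - gradD q x"
    by (rule linear_into_Linfty_diff[OF linear_grad])
  have "(LINT x|?M. ?d x) = 0"
    using flux[of "r - q"] by (simp only: Bochner_Integration.integral_diff[OF int int] diff_self)
  moreover have "AE x in ?M. 0 \<le> ?d x"
    using diff
  proof (rule eventually_mono)
    fix x assume "gradD (r - q) x = gradD r x - gradD q x"
    then show "0 \<le> ?d x"
      using flux_monotone[OF rho, of "gradD r x" "gradD q x"] by (simp only: inner_diff_left)
  qed
  ultimately have "AE x in ?M. ?d x = 0"
    using integral_nonneg_eq_0_iff_AE[OF Bochner_Integration.integrable_diff[OF int int]] by simp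
  then have "AE x in ?M. norm (gradD (r - q) x) = 0"
    using diff
  proof eventually_elim
    case (elim x)
    then have "(?F r x - ?F q x) \<bullet> (gradD r x - gradD q x) = 0"
      by (simp only: inner_diff_left)
    then have "gradD r x = gradD q x"
      using flux_strictly_monotone[OF rho, of "gradD r x" "gradD q x"] by (metis less_irrefl)
    then show ?case using elim by simp
  qed
  then have "(LINT x|?M. norm (gradD (r - q) x)) = 0"
    by (rule integral_eq_zero_AE)
  then have "GD_norm \<Omega> PiD gradD (r - q) = 0"
    using mean by (simp add: GD_norm_def mean_diff[OF lmeas])
  then show ?thesis
    using is_norm_eq_0_iff[OF norm] by simp
qed

end

section \<open>Existence and uniqueness of the nonlinear projection\<close>

theorem lemma3p2:
  fixes \<Omega> :: "(real^2) set"
    and \<rho> :: real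
    and N :: nat
    and T :: "(real^2) set set"
    and PiD :: "'x::real_vector \<Rightarrow> real^2 \<Rightarrow> real"
    and gradD :: "'x \<Rightarrow> real^2 \<Rightarrow> real^2"
    and u :: "real^2 \<Rightarrow> real"
    and gradu :: "real^2 \<Rightarrow> real^2"
  assumes "bounded_lipschitz_domain \<Omega>"
    and "\<rho> > 0"
    and "gradient_discretisation \<Omega> N T PiD gradD"
    and "u \<in> W1_infty \<Omega>"
    and "is_bounded_weak_gradient \<Omega> u gradu"
  shows "\<exists>!p :: 'x.
    (LINT x|lebesgue_on \<Omega>. PiD p x) = (LINT x|lebesgue_on \<Omega>. u x) \<and>
    (\<forall>w. (LINT x|lebesgue_on \<Omega>. (gradD p x /\<^sub>R rho_norm \<rho> (gradD p x)) \<bullet> gradD w x) =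
         (LINT x|lebesgue_on \<Omega>. (gradu x /\<^sub>R rho_norm \<rho> (gradu x)) \<bullet> gradD w x))"
proof -
  note rho = \<open>\<rho> > 0\<close> and GD = \<open>gradient_discretisation \<Omega> N T PiD gradD\<close>
  have domain: "open \<Omega>" "bounded \<Omega>" "\<Omega> \<noteq> {}"
    using assms(1) by (auto simp: bounded_lipschitz_domain_def)
  have lmeas: "\<Omega> \<in> lmeasurable" using domain by (simp add: lmeasurable_open)
  \<comment> \<open>Correcting the mean by a multiple of the unit element divides by this
    area.\<close>
  have area: "measure lebesgue \<Omega> \<noteq> 0"
    using open_not_negligible[OF domain(1,3)] lmeas by (auto simp: negligible_iff_measure)
  have gradu: "gradu \<in> Linfty \<Omega>" using assms(5) by (simp add: is_bounded_weak_gradient_def)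
  let ?G = "\<lambda>x. gradu x /\<^sub>R rho_norm \<rho> (gradu x)"
  have G: "?G \<in> Linfty \<Omega>" by (rule Linfty_flux[OF rho gradu])
  obtain C where C: "AE x in lebesgue_on \<Omega>. norm (gradu x) \<le> C"
    using gradu by (auto simp: Linfty_def)
  \<comment> \<open>Here \<open>\<rho> > 0\<close> turns the finite bound on the gradient into a
    flux bound strictly below 1.\<close>
  have "C < sqrt (\<rho>\<^sup>2 + C\<^sup>2)" using rho by (intro real_less_rsqrt) simp
  then have c: "C / sqrt (\<rho>\<^sup>2 + C\<^sup>2) < 1"
    using rho by (simp add: divide_less_eq add_pos_nonneg)
  have Gc: "AE x in lebesgue_on \<Omega>. norm (?G x) \<le> C / sqrt (\<rho>\<^sup>2 + C\<^sup>2)"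
    using C by (rule eventually_mono) (rule norm_flux_le[OF rho])
  obtain q where mean_q: "(LINT x|lebesgue_on \<Omega>. PiD q x) = (LINT x|lebesgue_on \<Omega>. u x)"
    and min_q: "\<And>v. energy \<Omega> \<rho> ?G (gradD q) \<le> energy \<Omega> \<rho> ?G (gradD v)"
    using gradient_discretisation.minimiser_exists[OF GD lmeas area rho G Gc c,
        of "LINT x|lebesgue_on \<Omega>. u x"] by auto
  note flux_q = gradient_discretisation.euler_lagrange[OF GD lmeas rho G min_q]
  show ?thesis
  proof (rule ex1I[of _ q], intro conjI allI)
    fix r
    assume r: "(LINT x|lebesgue_on \<Omega>. PiD r x) = (LINT x|lebesgue_on \<Omega>. u x) \<and>
      (\<forall>w. (LINT x|lebesgue_on \<Omega>. (gradD r x /\<^sub>R rho_norm \<rho> (gradD r x)) \<bullet> gradD w x) =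
           (LINT x|lebesgue_on \<Omega>. ?G x \<bullet> gradD w x))"
    show "r = q"
    proof (rule gradient_discretisation.flux_solution_unique[OF GD lmeas rho])
      show "(LINT x|lebesgue_on \<Omega>. PiD r x) = (LINT x|lebesgue_on \<Omega>. PiD q x)"
        by (rule trans[OF conjunct1[OF r] mean_q[symmetric]])
      show "(LINT x|lebesgue_on \<Omega>. (gradD r x /\<^sub>R rho_norm \<rho> (gradD r x)) \<bullet> gradD w x) =
          (LINT x|lebesgue_on \<Omega>. (gradD q x /\<^sub>R rho_norm \<rho> (gradD q x)) \<bullet> gradD w x)" for w
        by (rule trans[OF spec[OF conjunct2[OF r]] flux_q[symmetric]])
    qed
  qed (rule mean_q, rule flux_q)
qed

end
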